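(* Let $\mathcal{H}^n$ be an $n$-dimensional real or complex Hilbert space ($n\ge 1$), let $\Phi=\{\varphi_i\}_{i=1}^N$ be a frame for $\mathcal{H}^n$ with frame operator $S_\Phi$, and let $\Psi=S_\Phi^{-1}\Phi=\{S_\Phi^{-1}\varphi_i\}_{i=1}^N$ be the canonical dual frame of $\Phi$. Then $$\mathcal{R}_{\Phi}^{-}\,k(S_\Phi)^{-2}\le \mathcal{R}_{\Psi}^{-}\le \mathcal{R}_{\Phi}^{-}\,k(S_\Phi)^{2}\quad\text{and}\quad \mathcal{R}_{\Phi}^{+}\,k(S_\Phi)^{-2}\le \mathcal{R}_{\Psi}^{+}\le \mathcal{R}_{\Phi}^{+}\,k(S_\Phi)^{2},$$ where $k(S_\Phi)=\|S_\Phi\|\,\|S_\Phi^{-1}\|$ is the condition number of $S_\Phi$.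
   Context: The frame operator of a frame $\Phi=\{\varphi_i\}_{i=1}^N$ is $S_\Phi x=\sum_{i=1}^N\langle x,\varphi_i\rangle\varphi_i$. With $\mathbb{S}=\{x\in\mathcal{H}^n:\|x\|=1\}$, the redundancy function of $\Phi$ is $\mathcal{R}_\Phi:\mathbb{S}\to\mathbb{R}^+$, $\mathcal{R}_\Phi(x)=\sum_{i=1}^N\|P_{\langle\varphi_i\rangle}(x)\|^2$, where $P_{\langle\varphi_i\rangle}$ is the orthogonal projection onto $\langle\varphi_i\rangle=\operatorname{span}\{\varphi_i\}$. The upper and lower redundancies are $\mathcal{R}_\Phi^+=\sup_{x\in\mathbb{S}}\mathcal{R}_\Phi(x)$ and $\mathcal{R}_\Phi^-=\inf_{x\in\mathbb{S}}\mathcal{R}_\Phi(x)$. *)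

theory Defs
  imports "HOL-Analysis.Analysis"
begin

text \<open>The scalar field is \<open>\<real>\<close> or \<open>\<complex>\<close>: up to a norm-preserving field isomorphism these are the
  only members of the following class.  For such a field \<open>rc_conj\<close> is complex conjugation, which is
  the identity in the real case.\<close>

class real_or_complex = real_normed_field +
  fixes to_complex :: "'a \<Rightarrow> complex"
    and rc_conj :: "'a \<Rightarrow> 'a"
  assumes to_complex_add: "to_complex (x + y) = to_complex x + to_complex y"
    and to_complex_mult: "to_complex (x * y) = to_complex x * to_complex y"
    and to_complex_scaleR: "to_complex (scaleR r x) = scaleR r (to_complex x)"
    and norm_to_complex: "norm (to_complex x) = norm x"
    and range_to_complex: "range to_complex = \<real> \<or> range to_complex = UNIV"
    and to_complex_conj: "to_complex (rc_conj x) = cnj (to_complex x)"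

instantiation real :: real_or_complex
begin
definition to_complex_real :: "real \<Rightarrow> complex" where "to_complex_real = complex_of_real"
definition rc_conj_real :: "real \<Rightarrow> real" where "rc_conj_real x = x"
instance
  by standard (auto simp: to_complex_real_def rc_conj_real_def Reals_def scaleR_conv_of_real)
end

instantiation complex :: real_or_complex
begin
definition to_complex_complex :: "complex \<Rightarrow> complex" where "to_complex_complex x = x"
definition rc_conj_complex :: "complex \<Rightarrow> complex" where "rc_conj_complex = cnj"
instance
  by standard (auto simp: to_complex_complex_def rc_conj_complex_def)
end

text \<open>A Hilbert space of finite dimension \<open>n\<close> over \<open>'k\<close>; the inner product \<open>ip\<close> is linear in its
  first argument.  The norm of the carrier type is required to be the one induced by \<open>ip\<close>;
  completeness is automatic in finite dimension.\<close>

locale fin_dim_hilbert_space = vector_space smul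
  for smul :: "'k::real_or_complex \<Rightarrow> 'v::real_normed_vector \<Rightarrow> 'v" +
  fixes ip :: "'v \<Rightarrow> 'v \<Rightarrow> 'k" and n :: nat
  assumes scale_of_real: "smul (of_real r) x = r *\<^sub>R x"
    and ip_add_left: "ip (x + y) z = ip x z + ip y z"
    and ip_scale_left: "ip (smul c x) y = c * ip x y"
    and ip_commute: "ip y x = rc_conj (ip x y)"
    and ip_self: "ip x x = of_real ((norm x)\<^sup>2)"
    and finite_dim: "\<exists>B. finite B \<and> span B = UNIV"
    and dim_eq: "dim UNIV = n"

definition is_frame :: "('v::real_normed_vector \<Rightarrow> 'v \<Rightarrow> 'k::real_or_complex) \<Rightarrow> nat \<Rightarrow> (nat \<Rightarrow> 'v) \<Rightarrow> bool"
  where "is_frame ip N \<phi> \<longleftrightarrow>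
    (\<exists>A B. 0 < A \<and> A \<le> B \<and>
      (\<forall>x. A * (norm x)\<^sup>2 \<le> (\<Sum>i=1..N. (norm (ip x (\<phi> i)))\<^sup>2) \<and>
           (\<Sum>i=1..N. (norm (ip x (\<phi> i)))\<^sup>2) \<le> B * (norm x)\<^sup>2))"

definition frame_op ::
    "('k::real_or_complex \<Rightarrow> 'v::real_normed_vector \<Rightarrow> 'v) \<Rightarrow> ('v \<Rightarrow> 'v \<Rightarrow> 'k) \<Rightarrow> nat \<Rightarrow> (nat \<Rightarrow> 'v) \<Rightarrow> 'v \<Rightarrow> 'v"
  where "frame_op smul ip N \<phi> x = (\<Sum>i=1..N. smul (ip x (\<phi> i)) (\<phi> i))"

text \<open>The frame operator of a frame is bijective, so \<open>inv\<close> is its genuine two-sided inverse here and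
  in \<open>condition_number\<close>.\<close>

definition canonical_dual ::
    "('k::real_or_complex \<Rightarrow> 'v::real_normed_vector \<Rightarrow> 'v) \<Rightarrow> ('v \<Rightarrow> 'v \<Rightarrow> 'k) \<Rightarrow> nat \<Rightarrow> (nat \<Rightarrow> 'v) \<Rightarrow> nat \<Rightarrow> 'v"
  where "canonical_dual smul ip N \<phi> i = inv (frame_op smul ip N \<phi>) (\<phi> i)"

definition condition_number :: "('v::real_normed_vector \<Rightarrow> 'v) \<Rightarrow> real"
  where "condition_number T = onorm T * onorm (inv T)"

definition orth_proj :: "('v::real_normed_vector \<Rightarrow> 'v \<Rightarrow> 'k::real_or_complex) \<Rightarrow> 'v set \<Rightarrow> 'v \<Rightarrow> 'v"
  where "orth_proj ip U x = (THE p. p \<in> U \<and> (\<forall>u\<in>U. ip (x - p) u = 0))"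

definition redundancy ::
    "('k::real_or_complex \<Rightarrow> 'v::real_normed_vector \<Rightarrow> 'v) \<Rightarrow> ('v \<Rightarrow> 'v \<Rightarrow> 'k) \<Rightarrow> nat \<Rightarrow> (nat \<Rightarrow> 'v) \<Rightarrow> 'v \<Rightarrow> real"
  where "redundancy smul ip N \<phi> x =
    (\<Sum>i=1..N. (norm (orth_proj ip (module.span smul {\<phi> i}) x))\<^sup>2)"

definition upper_redundancy ::
    "('k::real_or_complex \<Rightarrow> 'v::real_normed_vector \<Rightarrow> 'v) \<Rightarrow> ('v \<Rightarrow> 'v \<Rightarrow> 'k) \<Rightarrow> nat \<Rightarrow> (nat \<Rightarrow> 'v) \<Rightarrow> real"
  where "upper_redundancy smul ip N \<phi> = (SUP x\<in>sphere 0 1. redundancy smul ip N \<phi> x)"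

definition lower_redundancy ::
    "('k::real_or_complex \<Rightarrow> 'v::real_normed_vector \<Rightarrow> 'v) \<Rightarrow> ('v \<Rightarrow> 'v \<Rightarrow> 'k) \<Rightarrow> nat \<Rightarrow> (nat \<Rightarrow> 'v) \<Rightarrow> real"
  where "lower_redundancy smul ip N \<phi> = (INF x\<in>sphere 0 1. redundancy smul ip N \<phi> x)"

end

theory Submission
  imports Defs
begin

text \<open>For a unit vector \<open>y\<close> put \<open>x = S y / \<parallel>S y\<parallel>\<close>; this is a surjection of the unit sphere onto itself.
  As \<open>S\<close> is self-adjoint, \<open>\<langle>x, S\<^sup>-\<^sup>1 \<phi>\<^sub>i\<rangle> = \<langle>y, \<phi>\<^sub>i\<rangle> / \<parallel>S y\<parallel>\<close>, so the redundancy of the dual frame at \<open>x\<close>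
  is the sum of \<open>|\<langle>y, \<phi>\<^sub>i\<rangle>|\<^sup>2 / (\<parallel>S y\<parallel> \<parallel>S\<^sup>-\<^sup>1 \<phi>\<^sub>i\<parallel>)\<^sup>2\<close>.  The product \<open>\<parallel>S y\<parallel> \<parallel>S\<^sup>-\<^sup>1 \<phi>\<^sub>i\<parallel>\<close> differs from \<open>\<parallel>\<phi>\<^sub>i\<parallel>\<close>
  by a factor between \<open>1 / k\<close> and \<open>k\<close>, so the two redundancies, at \<open>x\<close> and at \<open>y\<close>, differ by a factor
  between \<open>k\<^sup>-\<^sup>2\<close> and \<open>k\<^sup>2\<close>.\<close>

section \<open>Scalars: identities transferred from the complex numbers along an injective
  embedding\<close>

lemma to_complex_eq_iff [simp]: "to_complex x = to_complex y \<longleftrightarrow> x = y"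
proof
  assume eq: "to_complex x = to_complex y"
  have "to_complex y + to_complex (x - y) = to_complex x"
    by (simp flip: to_complex_add)
  then have "norm (to_complex (x - y)) = 0"
    using eq by simp
  then show "x = y"
    by (simp add: norm_to_complex)
qed simp

text \<open>The image of 1 is idempotent, hence 0 or 1, and 0 is excluded because
  \<open>to_complex\<close> preserves the norm.\<close>

lemma to_complex_1 [simp]: "to_complex (1::'a::real_or_complex) = 1"
proof -
  have "to_complex (1::'a) * to_complex (1::'a) = to_complex (1::'a)"
    by (metis mult_1 to_complex_mult)
  moreover have "to_complex (1::'a) \<noteq> 0"
    using norm_to_complex[of "1::'a"] by auto
  ultimately show ?thesis
    by simp
qed

lemma to_complex_of_real [simp]: "to_complex (of_real r :: 'a::real_or_complex) = of_real r"
  by (metis of_real_def to_complex_1 to_complex_scaleR)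

lemma rc_conj_add: "rc_conj (x + y) = rc_conj x + rc_conj y"
  by (simp add: to_complex_add to_complex_conj flip: to_complex_eq_iff)

lemma rc_conj_mult: "rc_conj (x * y) = rc_conj x * rc_conj y"
  by (simp add: to_complex_mult to_complex_conj flip: to_complex_eq_iff)

lemma norm_rc_conj [simp]: "norm (rc_conj x) = norm x"
  by (metis complex_mod_cnj norm_to_complex to_complex_conj)

lemma mult_rc_conj:
  fixes x :: "'a::real_or_complex"
  shows "x * rc_conj x = of_real ((norm x)\<^sup>2)"
proof -
  have "to_complex (x * rc_conj x) = of_real ((norm (to_complex x))\<^sup>2)"
    by (simp only: to_complex_mult to_complex_conj complex_norm_square)
  also have "\<dots> = to_complex (of_real ((norm x)\<^sup>2) :: 'a)"
    by (simp only: norm_to_complex to_complex_of_real)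
  finally show ?thesis
    by simp
qed

section \<open>Algebra of the inner product and its norm\<close>

context fin_dim_hilbert_space
begin

lemma ip_add_right: "ip z (x + y) = ip z x + ip z y"
  by (metis ip_add_left ip_commute rc_conj_add)

lemma ip_scale_right: "ip x (smul c y) = rc_conj c * ip x y"
  by (metis ip_commute ip_scale_left rc_conj_mult)

lemma ip_zero_left [simp]: "ip 0 x = 0"
  using ip_scale_left[of 0 x x] by simp

lemma ip_zero_right [simp]: "ip x 0 = 0"
  using ip_add_right[of x 0 0] by simp

lemma ip_diff_left: "ip (x - y) z = ip x z - ip y z"
  using ip_add_left[of "x - y" y z] by simp

lemma ip_sum_left: "ip (sum f I) y = (\<Sum>i\<in>I. ip (f i) y)"
  by (induction I rule: infinite_finite_induct) (auto simp: ip_add_left)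

lemma ip_sum_right: "ip y (sum f I) = (\<Sum>i\<in>I. ip y (f i))"
  by (induction I rule: infinite_finite_induct) (auto simp: ip_add_right)

lemma ip_eq_zero_commute: "ip x y = 0 \<longleftrightarrow> ip y x = 0"
  by (metis ip_commute norm_eq_zero norm_rc_conj)

lemma ip_mult_commute: "ip x y * ip y x = of_real ((norm (ip x y))\<^sup>2)"
  by (metis ip_commute mult_rc_conj)

lemma ip_scaleR_left: "ip (r *\<^sub>R x) y = of_real r * ip x y"
  by (metis ip_scale_left scale_of_real)

text \<open>The type class of the carrier gives homogeneity of the norm for real scalars only. For
  scalars in \<open>'k\<close> it comes from \<open>ip_self\<close>, by comparing squares.\<close>

lemma norm_smul: "norm (smul c x) = norm c * norm x"
proof -
  have "(of_real ((norm (smul c x))\<^sup>2) :: 'k) = c * rc_conj c * ip x x"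
    by (simp only: ip_self[symmetric] ip_scale_left ip_scale_right mult_ac)
  also have "\<dots> = of_real ((norm c * norm x)\<^sup>2)"
    by (simp add: mult_rc_conj ip_self power_mult_distrib)
  finally have "(norm (smul c x))\<^sup>2 = (norm c * norm x)\<^sup>2"
    by (simp only: of_real_eq_iff)
  then show ?thesis
    by (simp add: power2_eq_iff_nonneg)
qed

lemma norm_add_orthogonal:
  assumes "ip x y = 0"
  shows "(norm (x + y))\<^sup>2 = (norm x)\<^sup>2 + (norm y)\<^sup>2"
proof -
  have "ip y x = 0"
    using assms ip_eq_zero_commute by blast
  then have "(of_real ((norm (x + y))\<^sup>2) :: 'k) = of_real ((norm x)\<^sup>2 + (norm y)\<^sup>2)"
    using assms by (simp only: ip_self[symmetric] ip_add_left ip_add_right of_real_add) simp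
  then show ?thesis
    by (simp only: of_real_eq_iff)
qed

section \<open>Projection onto a line and the redundancy function\<close>

lemma ip_residual: "ip (x - smul (ip x u / of_real ((norm u)\<^sup>2)) u) u = 0"
  by (cases "u = 0") (simp_all add: ip_diff_left ip_scale_left ip_self)

text \<open>For \<open>u = 0\<close> both sides are 0, since division by zero yields 0; vanishing
  frame vectors thus fit the same formula.\<close>

lemma norm_component: "norm (smul (ip x u / of_real ((norm u)\<^sup>2)) u) = norm (ip x u) / norm u"
  by (cases "u = 0") (simp_all add: norm_smul norm_divide norm_mult power2_eq_square)

text \<open>Pythagoras, applied to the splitting of \<open>x\<close> into its component along
  \<open>u\<close> and the orthogonal residual. Cauchy-Schwarz is then a rearrangement.\<close>

lemma norm_component_le: "norm (ip x u) / norm u \<le> norm x"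
proof -
  let ?p = "smul (ip x u / of_real ((norm u)\<^sup>2)) u"
  have "ip (x - ?p) ?p = 0"
    by (subst ip_scale_right) (simp add: ip_residual del: of_real_power)
  then have "(norm ((x - ?p) + ?p))\<^sup>2 = (norm (x - ?p))\<^sup>2 + (norm ?p)\<^sup>2"
    by (rule norm_add_orthogonal)
  then have "(norm ?p)\<^sup>2 \<le> (norm x)\<^sup>2"
    by simp
  then have "norm ?p \<le> norm x"
    by (simp add: power2_le_iff_abs_le)
  then show ?thesis
    by (simp only: norm_component)
qed

lemma Cauchy_Schwarz: "norm (ip x y) \<le> norm x * norm y"
  using norm_component_le[of x y] by (cases "y = 0") (simp_all add: divide_le_eq)

lemma orth_proj_span_singleton:
  "orth_proj ip (span {u}) x = smul (ip x u / of_real ((norm u)\<^sup>2)) u" (is "_ = ?p")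
  unfolding orth_proj_def
proof (rule the_equality)
  have orth: "ip (x - ?p) v = 0" if "v \<in> span {u}" for v
    using that ip_residual[of x u] by (auto simp: span_singleton ip_scale_right)
  show "?p \<in> span {u} \<and> (\<forall>v\<in>span {u}. ip (x - ?p) v = 0)"
    using orth by (auto simp: span_singleton)
  fix q
  assume q: "q \<in> span {u} \<and> (\<forall>v\<in>span {u}. ip (x - q) v = 0)"
  have d: "?p - q \<in> span {u}"
    by (rule span_diff) (use q in \<open>auto simp: span_singleton\<close>)
  \<comment> \<open>Uniqueness for the definite description: the difference of two candidates lies
    in the line and is orthogonal to it, hence to itself.\<close>
  have "ip (?p - q) (?p - q) = ip (x - q) (?p - q) - ip (x - ?p) (?p - q)"
    by (simp flip: ip_diff_left)
  also have "\<dots> = 0"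
    using d q orth by simp
  finally show "q = ?p"
    by (simp add: ip_self)
qed

lemma redundancy_eq: "redundancy smul ip N \<phi> x = (\<Sum>i=1..N. (norm (ip x (\<phi> i)) / norm (\<phi> i))\<^sup>2)"
  by (simp only: redundancy_def orth_proj_span_singleton norm_component)

lemma redundancy_nonneg: "0 \<le> redundancy smul ip N \<phi> x"
  by (simp add: redundancy_eq sum_nonneg)

text \<open>Every projection is a contraction. The bound makes the supremum over the unit sphere
  meaningful.\<close>

lemma redundancy_le: "redundancy smul ip N \<phi> x \<le> N * (norm x)\<^sup>2"
proof -
  have "redundancy smul ip N \<phi> x \<le> (\<Sum>i=1..N. (norm x)\<^sup>2)"
    unfolding redundancy_eq by (intro sum_mono power_mono norm_component_le) simp
  then show ?thesis
    by simp
qed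

text \<open>Positive dimension rules out the zero space, and any nonzero vector can be normalized.
  Infima and suprema over the sphere are then taken over a nonempty set.\<close>

lemma sphere_nonempty:
  assumes "1 \<le> n"
  shows "sphere (0::'v) 1 \<noteq> {}"
proof -
  have "UNIV \<noteq> {0::'v}"
  proof
    assume eq: "UNIV = {0::'v}"
    have "dim (span ({}::'v set)) = 0"
      by (metis card.empty dim_eq_card_independent dim_span independent_empty)
    then show False
      using assms dim_eq eq by simp
  qed
  then obtain x :: 'v where "x \<noteq> 0"
    by blast
  then have "x /\<^sub>R norm x \<in> sphere 0 1"
    by simp
  then show ?thesis
    by blast
qed

section \<open>The frame operator and its inverse\<close>

lemma ip_frame_op_self:
  "ip (frame_op smul ip N \<phi> x) x = of_real (\<Sum>i=1..N. (norm (ip x (\<phi> i)))\<^sup>2)"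
  by (simp only: frame_op_def ip_sum_left ip_scale_left ip_mult_commute of_real_sum)

text \<open>Both sides expand to the sum of
  \<open>ip x (\<phi> i) * ip (\<phi> i) y\<close>.\<close>

lemma frame_op_selfadjoint: "ip (frame_op smul ip N \<phi> x) y = ip x (frame_op smul ip N \<phi> y)"
proof -
  have "rc_conj (ip y (\<phi> i)) * ip x (\<phi> i) = ip x (\<phi> i) * ip (\<phi> i) y" for i
    by (simp flip: ip_commute)
  then show ?thesis
    by (simp only: frame_op_def ip_sum_left ip_sum_right ip_scale_left ip_scale_right)
qed

lemma frame_op_add: "frame_op smul ip N \<phi> (x + y) = frame_op smul ip N \<phi> x + frame_op smul ip N \<phi> y"
  by (simp add: frame_op_def ip_add_left scale_left_distrib sum.distrib)

lemma frame_op_smul: "frame_op smul ip N \<phi> (smul c x) = smul c (frame_op smul ip N \<phi> x)"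
  by (simp add: frame_op_def ip_scale_left scale_sum_right)

lemma bounded_linear_frame_op: "bounded_linear (frame_op smul ip N \<phi>)"
proof (rule bounded_linear_intro)
  fix x y :: 'v and r :: real
  show "frame_op smul ip N \<phi> (x + y) = frame_op smul ip N \<phi> x + frame_op smul ip N \<phi> y"
    by (rule frame_op_add)
  show "frame_op smul ip N \<phi> (r *\<^sub>R x) = r *\<^sub>R frame_op smul ip N \<phi> x"
    by (metis frame_op_smul scale_of_real)
  have "norm (frame_op smul ip N \<phi> x) \<le> (\<Sum>i=1..N. norm (ip x (\<phi> i)) * norm (\<phi> i))"
    by (simp add: frame_op_def norm_smul sum_norm_le)
  also have "\<dots> \<le> (\<Sum>i=1..N. norm x * norm (\<phi> i) * norm (\<phi> i))"
    by (intro sum_mono mult_right_mono Cauchy_Schwarz) simp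
  also have "\<dots> = norm x * (\<Sum>i=1..N. norm (\<phi> i) * norm (\<phi> i))"
    by (simp add: sum_distrib_left mult.assoc)
  finally show "norm (frame_op smul ip N \<phi> x) \<le> norm x * (\<Sum>i=1..N. norm (\<phi> i) * norm (\<phi> i))" .
qed

text \<open>The lower frame bound estimates \<open>ip (S x) x\<close>, where \<open>S\<close> is the
  frame operator, from below by \<open>A * (norm x)\<^sup>2\<close>. Cauchy-Schwarz bounds it from
  above by \<open>norm (S x) * norm x\<close>, and one factor \<open>norm x\<close> cancels.\<close>

lemma frame_op_bounded_below:
  assumes "is_frame ip N \<phi>"
  obtains A where "0 < A" "\<And>x. A * norm x \<le> norm (frame_op smul ip N \<phi> x)"
proof -
  obtain A where A: "0 < A" "\<And>x. A * (norm x)\<^sup>2 \<le> (\<Sum>i=1..N. (norm (ip x (\<phi> i)))\<^sup>2)"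
    using assms by (auto simp: is_frame_def)
  have "A * norm x \<le> norm (frame_op smul ip N \<phi> x)" for x
  proof (cases "x = 0")
    case False
    have "A * norm x * norm x \<le> (\<Sum>i=1..N. (norm (ip x (\<phi> i)))\<^sup>2)"
      using A(2)[of x] by (simp add: power2_eq_square mult.assoc)
    also have "\<dots> = norm (ip (frame_op smul ip N \<phi> x) x)"
      by (simp only: ip_frame_op_self norm_of_real) (simp add: sum_nonneg)
    also have "\<dots> \<le> norm (frame_op smul ip N \<phi> x) * norm x"
      by (rule Cauchy_Schwarz)
    finally show ?thesis
      using False by simp
  qed simp
  with A(1) show ?thesis
    using that by blast
qed

lemma bij_frame_op:
  assumes "is_frame ip N \<phi>"
  shows "bij (frame_op smul ip N \<phi>)"
proof -
  let ?S = "frame_op smul ip N \<phi>"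
  obtain A where A: "0 < A" "\<And>x. A * norm x \<le> norm (?S x)"
    using frame_op_bounded_below[OF assms] by blast
  \<comment> \<open>A basis extracted from a finite spanning set gives access to the fact that an
    injective endomorphism is surjective in finite dimension.\<close>
  obtain B where "finite B" "span B = UNIV"
    using finite_dim by blast
  moreover obtain C where "C \<subseteq> B" "independent C" "B \<subseteq> span C"
    using maximal_independent_subset by blast
  ultimately have "finite C" "span C = UNIV"
    using span_minimal[OF _ subspace_span, of B C] by (auto intro: finite_subset)
  with \<open>independent C\<close> interpret fd: finite_dimensional_vector_space smul C
    by unfold_locales auto
  have lin: "Vector_Spaces.linear smul smul ?S"
    by unfold_locales (simp_all add: frame_op_add frame_op_smul)
  have "inj ?S"
  proof (rule injI)
    fix x y
    assume "?S x = ?S y"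
    then have "?S (x - y) = 0"
      using bounded_linear.linear[OF bounded_linear_frame_op, of N \<phi>] by (simp add: linear_diff)
    then have "A * norm (x - y) \<le> 0"
      using A(2)[of "x - y"] by simp
    then show "x = y"
      using A(1) by (simp add: mult_le_0_iff)
  qed
  with fd.linear_inj_imp_surj[OF lin] show ?thesis
    by (simp add: bij_def)
qed

text \<open>The lower bound \<open>A\<close> for the frame operator becomes the bound
  \<open>1 / A\<close> for its inverse, so that \<open>onorm\<close> of the inverse obeys its usual
  estimates.\<close>

lemma bounded_linear_inv_frame_op:
  assumes "is_frame ip N \<phi>"
  shows "bounded_linear (inv (frame_op smul ip N \<phi>))"
proof -
  let ?S = "frame_op smul ip N \<phi>"
  have bij: "bij ?S"
    using assms by (rule bij_frame_op)
  obtain A where A: "0 < A" "\<And>x. A * norm x \<le> norm (?S x)"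
    using frame_op_bounded_below[OF assms] by blast
  show ?thesis
  proof (rule bounded_linear_intro)
    fix x y :: 'v and r :: real
    show "inv ?S (x + y) = inv ?S x + inv ?S y"
      using bij by (intro inv_f_eq) (auto simp: frame_op_add bij_is_inj bij_is_surj surj_f_inv_f)
    show "inv ?S (r *\<^sub>R x) = r *\<^sub>R inv ?S x"
      using bij bounded_linear_frame_op[of N \<phi>]
      by (intro inv_f_eq) (auto simp: linear_simps bij_is_inj bij_is_surj surj_f_inv_f)
    show "norm (inv ?S x) \<le> norm x * (1 / A)"
      using A(1) A(2)[of "inv ?S x"] bij by (simp add: field_simps bij_is_surj surj_f_inv_f)
  qed
qed

section \<open>Pointwise comparison of the two redundancies\<close>

lemma redundancy_canonical_dual:
  assumes "is_frame ip N \<phi>"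
  defines "S \<equiv> frame_op smul ip N \<phi>"
  shows "redundancy smul ip N (canonical_dual smul ip N \<phi>) (S y /\<^sub>R norm (S y))
    = (\<Sum>i=1..N. (norm (ip y (\<phi> i)) / (norm (S y) * norm (inv S (\<phi> i))))\<^sup>2)"
proof -
  have "ip (S y) (inv S (\<phi> i)) = ip y (\<phi> i)" for i
    using bij_frame_op[OF assms(1)] frame_op_selfadjoint[of N \<phi> y "inv S (\<phi> i)"]
    by (simp add: S_def bij_is_surj surj_f_inv_f)
  then show ?thesis
    by (simp add: redundancy_eq canonical_dual_def ip_scaleR_left norm_mult norm_inverse divide_inverse
        mult_ac flip: S_def)
qed

lemma
  assumes "is_frame ip N \<phi>" "norm y = 1"
  defines "S \<equiv> frame_op smul ip N \<phi>"
  shows redundancy_canonical_dual_le: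
      "redundancy smul ip N (canonical_dual smul ip N \<phi>) (S y /\<^sub>R norm (S y))
        \<le> (condition_number S)\<^sup>2 * redundancy smul ip N \<phi> y" (is ?upper)
    and redundancy_le_canonical_dual:
      "redundancy smul ip N \<phi> y \<le> (condition_number S)\<^sup>2 *
        redundancy smul ip N (canonical_dual smul ip N \<phi>) (S y /\<^sub>R norm (S y))" (is ?lower)
proof -
  let ?a = "onorm S" and ?b = "onorm (inv S)" and ?k = "condition_number S"
  note S = bounded_linear_frame_op[of N \<phi>, folded S_def]
  note invS = bounded_linear_inv_frame_op[OF assms(1), folded S_def]
  note bij = bij_frame_op[OF assms(1), folded S_def]
  have [simp]: "S (inv S x) = x" "inv S (S x) = x" for x
    using bij by (simp_all add: bij_is_surj surj_f_inv_f bij_is_inj)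
  have [simp]: "S 0 = 0" "inv S 0 = 0"
    using S invS by (simp_all add: linear_simps)
  have nz: "inv S x = 0 \<longleftrightarrow> x = 0" "S x = 0 \<longleftrightarrow> x = 0" for x
    by (metis \<open>S 0 = 0\<close> \<open>inv S 0 = 0\<close> \<open>\<And>x. S (inv S x) = x\<close> \<open>\<And>x. inv S (S x) = x\<close>)+
  have y: "norm (S y) \<le> ?a" "1 \<le> ?b * norm (S y)" "0 < norm (S y)"
    using onorm[OF S, of y] onorm[OF invS, of "S y"] assms(2) nz(2)[of y] by auto
  have [simp]: "0 \<le> ?a" "0 \<le> ?b"
    using S invS by (auto intro: onorm_pos_le)
  have k: "?k = ?a * ?b"
    by (simp add: condition_number_def)
  \<comment> \<open>Write \<open>v = S (inv S v)\<close> to get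
    \<open>norm v \<le> ?a * norm (inv S v)\<close>, then multiply by
    \<open>1 \<le> ?b * norm (S y)\<close>, which comes from \<open>y = inv S (S y)\<close>.\<close>
  have up: "norm v \<le> ?k * (norm (S y) * norm (inv S v))" for v
  proof -
    have "norm v * 1 \<le> (?a * norm (inv S v)) * (?b * norm (S y))"
      using onorm[OF S, of "inv S v"] y by (intro mult_mono) auto
    then show ?thesis
      by (simp add: k mult_ac)
  qed
  \<comment> \<open>Here each factor is bounded by its own operator norm, using
    \<open>norm y = 1\<close>.\<close>
  have low: "norm (S y) * norm (inv S v) \<le> ?k * norm v" for v
  proof -
    have "norm (S y) * norm (inv S v) \<le> ?a * (?b * norm v)"
      using onorm[OF invS, of v] y by (intro mult_mono) auto
    then show ?thesis
      by (simp add: k mult_ac)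
  qed
  \<comment> \<open>The termwise bound, to be used with \<open>c = ip y (\<phi> i)\<close> and
    \<open>v = \<phi> i\<close>. For \<open>v = 0\<close> both quotients are 0 by
    convention.\<close>
  have "norm c / (norm (S y) * norm (inv S v)) \<le> ?k * (norm c / norm v)" for c :: 'k and v
    using mult_left_mono[OF up[of v], of "norm c"] y(3) nz(1)[of v]
    by (cases "v = 0") (simp_all add: field_simps)
  then show ?upper
    unfolding redundancy_canonical_dual[OF assms(1), folded S_def]
    unfolding redundancy_eq sum_distrib_left power_mult_distrib[symmetric]
    by (intro sum_mono power_mono) auto
  have "norm c / norm v \<le> ?k * (norm c / (norm (S y) * norm (inv S v)))" for c :: 'k and v
    using mult_left_mono[OF low[of v], of "norm c"] y(3) nz(1)[of v]
    by (cases "v = 0") (simp_all add: field_simps)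
  then show ?lower
    unfolding redundancy_canonical_dual[OF assms(1), folded S_def]
    unfolding redundancy_eq sum_distrib_left power_mult_distrib[symmetric]
    by (intro sum_mono power_mono) auto
qed

end

section \<open>Reparametrizing the sphere and passing to extrema\<close>

lemma image_normalized_sphere:
  fixes T :: "'v::real_normed_vector \<Rightarrow> 'v"
  assumes "linear T" "bij T"
  shows "(\<lambda>y. T y /\<^sub>R norm (T y)) ` sphere 0 1 = sphere 0 1"
proof -
  have nz: "T y = 0 \<longleftrightarrow> y = 0" for y
    using assms by (metis bij_is_inj injD linear_0)
  show ?thesis
  proof (intro equalityI subsetI)
    fix x :: 'v
    assume x: "x \<in> sphere 0 1"
    obtain z where z: "T z = x"
      using assms(2) by (metis bij_is_surj surjD)
    have "z \<noteq> 0"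
      using x z nz[of z] by auto
    \<comment> \<open>The normalized preimage is the witness: the positive factor
      \<open>1 / norm z\<close> disappears when its image is normalized, because \<open>x\<close> is
      a unit vector.\<close>
    have "T (z /\<^sub>R norm z) = x /\<^sub>R norm z"
      using linear_cmul[OF assms(1)] z by simp
    with x \<open>z \<noteq> 0\<close> show "x \<in> (\<lambda>y. T y /\<^sub>R norm (T y)) ` sphere 0 1"
      by (intro image_eqI[of _ _ "z /\<^sub>R norm z"]) simp_all
  next
    fix x
    assume "x \<in> (\<lambda>y. T y /\<^sub>R norm (T y)) ` sphere 0 1"
    then obtain y where "norm y = 1" and x: "x = T y /\<^sub>R norm (T y)"
      by auto
    then have "T y \<noteq> 0"
      using nz[of y] by auto
    then show "x \<in> sphere 0 1"
      by (simp add: x)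
  qed
qed

text \<open>Since \<open>h\<close> maps \<open>X\<close> onto itself, precomposing \<open>g\<close>
  with \<open>h\<close> leaves its extrema unchanged, so a pointwise estimate at shifted arguments
  passes to them.\<close>

lemma
  fixes f g :: "'a \<Rightarrow> real"
  assumes "X \<noteq> {}" "0 \<le> c" "h ` X = X"
    and le: "\<And>x. x \<in> X \<Longrightarrow> g (h x) \<le> c * f x"
  shows cINF_le_mult: "bdd_below (g ` X) \<Longrightarrow> 0 < c \<Longrightarrow> (INF x\<in>X. g x) \<le> c * (INF x\<in>X. f x)"
    and cSUP_le_mult: "bdd_above (f ` X) \<Longrightarrow> (SUP x\<in>X. g x) \<le> c * (SUP x\<in>X. f x)"
proof -
  have eq: "g ` X = (\<lambda>x. g (h x)) ` X"
    using assms(3) image_image[of g h X] by simp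
  show "(INF x\<in>X. g x) \<le> c * (INF x\<in>X. f x)" if bdd: "bdd_below (g ` X)" and "0 < c"
  proof -
    \<comment> \<open>Division by \<open>c\<close> turns the infimum of \<open>g\<close> into a
      lower bound of \<open>f\<close> itself.\<close>
    have "(INF x\<in>X. g x) / c \<le> f x" if "x \<in> X" for x
    proof -
      have "(INF x\<in>X. g x) \<le> g (h x)"
        using that bdd assms(3) by (intro cINF_lower) auto
      with le[OF that] \<open>0 < c\<close> show ?thesis
        by (simp add: field_simps)
    qed
    then have "(INF x\<in>X. g x) / c \<le> (INF x\<in>X. f x)"
      using \<open>X \<noteq> {}\<close> by (intro cINF_greatest)
    with \<open>0 < c\<close> show ?thesis
      by (simp add: field_simps)
  qed
  show "(SUP x\<in>X. g x) \<le> c * (SUP x\<in>X. f x)" if "bdd_above (f ` X)"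
    unfolding eq using that assms(1,2)
    by (intro cSUP_least order_trans[OF le] mult_left_mono cSUP_upper)
qed

theorem proposition4p3:
  fixes smul :: "'k::real_or_complex \<Rightarrow> 'v::real_normed_vector \<Rightarrow> 'v"
    and ip :: "'v \<Rightarrow> 'v \<Rightarrow> 'k"
    and n N :: nat
    and \<phi> \<psi> :: "nat \<Rightarrow> 'v"
    and S :: "'v \<Rightarrow> 'v"
    and k :: real
  assumes "fin_dim_hilbert_space smul ip n"
    and "1 \<le> n"
    and "is_frame ip N \<phi>"
    and "S = frame_op smul ip N \<phi>"
    and "\<psi> = canonical_dual smul ip N \<phi>"
    and "k = condition_number S"
  shows "lower_redundancy smul ip N \<phi> * k powi (-2) \<le> lower_redundancy smul ip N \<psi>
       \<and> lower_redundancy smul ip N \<psi> \<le> lower_redundancy smul ip N \<phi> * k powi 2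
       \<and> upper_redundancy smul ip N \<phi> * k powi (-2) \<le> upper_redundancy smul ip N \<psi>
       \<and> upper_redundancy smul ip N \<psi> \<le> upper_redundancy smul ip N \<phi> * k powi 2"
proof -
  interpret fin_dim_hilbert_space smul ip n
    by fact
  let ?X = "sphere (0::'v) 1"
  let ?f = "redundancy smul ip N \<phi>" and ?g = "redundancy smul ip N \<psi>"
  let ?h = "\<lambda>y. S y /\<^sub>R norm (S y)"
  note S = bounded_linear_frame_op[of N \<phi>, folded \<open>S = _\<close>]
  note invS = bounded_linear_inv_frame_op[OF assms(3), folded \<open>S = _\<close>]
  note bij = bij_frame_op[OF assms(3), folded \<open>S = _\<close>]
  have X: "?X \<noteq> {}"
    using sphere_nonempty[OF \<open>1 \<le> n\<close>] .
  have h: "?h ` ?X = ?X"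
    using S bij by (intro image_normalized_sphere) (simp_all add: bounded_linear.linear)
  have bdd: "bdd_below (redundancy smul ip N \<omega> ` ?X)" "bdd_above (redundancy smul ip N \<omega> ` ?X)"
    for \<omega>
    using redundancy_nonneg[of N \<omega>] redundancy_le[of N \<omega>]
    by (auto intro!: bdd_belowI2[of _ 0] bdd_aboveI2[of _ _ "real N"]) (metis mult.right_neutral power_one)
  have le: "?g (?h y) \<le> k\<^sup>2 * ?f y" "?f y \<le> k\<^sup>2 * ?g (?h y)" if "y \<in> ?X" for y
    using that redundancy_canonical_dual_le[OF assms(3), of y]
      redundancy_le_canonical_dual[OF assms(3), of y]
    by (simp_all add: assms(4-6))
  \<comment> \<open>Applying \<open>inv S\<close> after \<open>S\<close> to a unit vector gives
    \<open>1 \<le> k\<close>. Positivity serves the infimum estimates and the final division by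
    \<open>k\<^sup>2\<close>.\<close>
  have "0 < k"
  proof -
    obtain y :: 'v where y: "norm y = 1"
      using X by auto
    have "1 = norm (inv S (S y))"
      using bij y by (simp add: bij_is_inj)
    also have "\<dots> \<le> onorm (inv S) * (onorm S * norm y)"
      by (intro order_trans[OF onorm[OF invS]] mult_left_mono onorm[OF S] onorm_pos_le[OF invS])
    finally show ?thesis
      using y assms(6) by (simp add: condition_number_def mult.commute)
  qed
  then have k: "0 \<le> k\<^sup>2" "0 < k\<^sup>2"
    by simp_all
  have INF_h: "(INF y\<in>?X. ?g (?h y)) = (INF x\<in>?X. ?g x)"
    and SUP_h: "(SUP y\<in>?X. ?g (?h y)) = (SUP x\<in>?X. ?g x)"
    and bdd_h: "bdd_above ((\<lambda>y. ?g (?h y)) ` ?X)"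
    using h bdd(2)[of \<psi>] image_image[of ?g ?h ?X] by simp_all
  have "(INF x\<in>?X. ?g x) \<le> k\<^sup>2 * (INF x\<in>?X. ?f x)"
    by (rule cINF_le_mult[OF X k(1) h le(1) bdd(1) k(2)])
  moreover have "(SUP x\<in>?X. ?g x) \<le> k\<^sup>2 * (SUP x\<in>?X. ?f x)"
    by (rule cSUP_le_mult[OF X k(1) h le(1) bdd(2)])
  \<comment> \<open>For the reverse estimates the dual redundancy already enters precomposed with
    \<open>?h\<close>, so the reparametrization is \<open>id\<close>; \<open>INF_h\<close> and
    \<open>SUP_h\<close> remove \<open>?h\<close> at the end.\<close>
  moreover have "(INF x\<in>?X. ?f x) \<le> k\<^sup>2 * (INF y\<in>?X. ?g (?h y))"
    using le(2) by (intro cINF_le_mult[OF X k(1), of id] bdd k(2)) simp_all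
  moreover have "(SUP x\<in>?X. ?f x) \<le> k\<^sup>2 * (SUP y\<in>?X. ?g (?h y))"
    using le(2) bdd_h by (intro cSUP_le_mult[OF X k(1), of id]) simp_all
  ultimately show ?thesis
    using k unfolding INF_h SUP_h lower_redundancy_def upper_redundancy_def
    by (simp add: power_int_minus field_simps)
qed

end
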